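(* For every integer $n\geq 5$, $\Pi(n)\geq \left\lceil \frac{n-2}{60}\right\rceil$. That is, for every simple polygon $P$ and every set $S$ of $n$ points of $P$ in general position, there exist $u,v\in S$ such that every geodesic disk through $u$ and $v$ contains at least $\left\lceil \frac{n-2}{60}\right\rceil$ points of $S$.
   Context: $P$ is a simple polygon (a closed region). For $a,b\in P$, $g(a,b)$ denotes the shortest (geodesic) path from $a$ to $b$ inside $P$ and $|g(a,b)|$ its length. A geodesic disk with center $c$ and radius $r$ is $D(c,r)=\{x\in P:|g(c,x)|\le r\}$; it is "through" some points if those points lie on its boundary (distance exactly $r$ from $c$), and contains a point if the point belongs to it. General position of $S$: no three points of $S$ are geodesically collinear (one on the geodesic path between the other two), no four points among $S$ and the vertices of $P$ lie on the boundary of a common geodesic disk, there are no $x,y\in S$ and reflex vertex $p$ of $P$ with $y\in g(x,p)$, and no geodesic bisector (set of points equidistant from two points) of two points of $S$ passes through a vertex of $P$. $\Pi(n)$ is the largest integer such that for every simple polygon $P$ and every set $S$ of $n$ points of $P$ in general position, there exist $u,v\in S$ such that every geodesic disk through $u$ and $v$ contains at least $\Pi(n)$ points of $S$. *)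

theory Defs
  imports "HOL-Analysis.Analysis"
begin

type_synonym pt = "real ^ 2"

definition pedge :: "pt list \<Rightarrow> nat \<Rightarrow> pt set" where
  "pedge vs i = closed_segment (vs ! i) (vs ! ((i + 1) mod length vs))"

definition polygon_boundary :: "pt list \<Rightarrow> pt set" where
  "polygon_boundary vs = (\<Union>i<length vs. pedge vs i)"

text \<open>A simple polygon given by its vertices in cyclic order: at least three
distinct vertices, no three cyclically consecutive vertices collinear (so the list
is exactly the set of corners), adjacent edges meet only in their common vertex,
and non-adjacent edges are disjoint.\<close>
definition simple_polygon_vertices :: "pt list \<Rightarrow> bool" where
  "simple_polygon_vertices vs \<longleftrightarrow>
     length vs \<ge> 3 \<and> distinct vs \<and>
     (\<forall>i<length vs. \<not> collinear {vs ! i, vs ! ((i + 1) mod length vs),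
                                     vs ! ((i + 2) mod length vs)}) \<and>
     (\<forall>i<length vs. \<forall>j<length vs. i \<noteq> j \<longrightarrow>
        (if j = (i + 1) mod length vs
         then pedge vs i \<inter> pedge vs j = {vs ! j}
         else if i = (j + 1) mod length vs
         then pedge vs i \<inter> pedge vs j = {vs ! i}
         else pedge vs i \<inter> pedge vs j = {}))"

definition polygon_region :: "pt list \<Rightarrow> pt set" where
  "polygon_region vs = polygon_boundary vs \<union> inside (polygon_boundary vs)"

definition reflex_vertex :: "pt list \<Rightarrow> pt \<Rightarrow> bool" where
  "reflex_vertex vs p \<longleftrightarrow> p \<in> set vs \<and>
     (\<forall>e>0. \<not> convex (polygon_region vs \<inter> ball p e))"

text \<open>Polygonal paths inside P (shortest paths inside a simple polygon are polygonal).\<close>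
definition poly_path_in :: "pt set \<Rightarrow> pt list \<Rightarrow> pt \<Rightarrow> pt \<Rightarrow> bool" where
  "poly_path_in P ps a b \<longleftrightarrow> ps \<noteq> [] \<and> hd ps = a \<and> last ps = b \<and>
     (\<forall>i. Suc i < length ps \<longrightarrow> closed_segment (ps ! i) (ps ! Suc i) \<subseteq> P)"

definition poly_len :: "pt list \<Rightarrow> real" where
  "poly_len ps = (\<Sum>i<length ps - 1. dist (ps ! i) (ps ! Suc i))"

definition poly_trace :: "pt list \<Rightarrow> pt set" where
  "poly_trace ps = set ps \<union> (\<Union>i\<in>{i. Suc i < length ps}. closed_segment (ps ! i) (ps ! Suc i))"

definition gdist :: "pt set \<Rightarrow> pt \<Rightarrow> pt \<Rightarrow> real" where
  "gdist P a b = Inf {poly_len ps | ps. poly_path_in P ps a b}"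

definition on_geodesic :: "pt set \<Rightarrow> pt \<Rightarrow> pt \<Rightarrow> pt \<Rightarrow> bool" where
  "on_geodesic P x y z \<longleftrightarrow>
     (\<exists>ps. poly_path_in P ps x z \<and> poly_len ps = gdist P x z \<and> y \<in> poly_trace ps)"

definition gdisk :: "pt set \<Rightarrow> pt \<Rightarrow> real \<Rightarrow> pt set" where
  "gdisk P c r = {x \<in> P. gdist P c x \<le> r}"

definition general_position :: "pt list \<Rightarrow> pt set \<Rightarrow> bool" where
  "general_position vs S \<longleftrightarrow>
     (let P = polygon_region vs in
      (\<forall>a\<in>S. \<forall>b\<in>S. \<forall>c\<in>S. a \<noteq> b \<and> b \<noteq> c \<and> a \<noteq> c \<longrightarrow> \<not> on_geodesic P a b c) \<and>
      (\<forall>c\<in>P. \<forall>r. \<forall>Q. Q \<subseteq> S \<union> set vs \<and> card Q = 4 \<longrightarrow>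
            \<not> (\<forall>q\<in>Q. gdist P c q = r)) \<and>
      (\<forall>x\<in>S. \<forall>y\<in>S. \<forall>p. x \<noteq> y \<and> reflex_vertex vs p \<longrightarrow> \<not> on_geodesic P x y p) \<and>
      (\<forall>x\<in>S. \<forall>y\<in>S. \<forall>w\<in>set vs. x \<noteq> y \<longrightarrow> gdist P x w \<noteq> gdist P y w))"

end

theory Submission
  imports Defs
begin

text \<open>Suppose every pair \<open>u\<close>, \<open>v\<close> of sites has a disk through it with fewer than \<open>(n - 2) / 60\<close> sites.
  A random map from five indices to the sites then has, with positive probability, the property that
  the disk chosen for any two of the five images contains no third one: there are 60 ordered
  triples of indices, each failing with probability below \<open>1 / 60\<close>.

  Join any two of these five sites through the centre of their disk by nearly shortest paths. Each
  of the two halves stays in the Voronoi cell of its end, so the curves of disjoint pairs are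
  disjoint, which contradicts the non-planarity of the complete graph on five vertices.

  Nearly shortest paths suffice, so the only property of the region that enters is that any two of
  its points are joined by a polygonal path in it.\<close>

section \<open>Increments of logarithms along paths\<close>

text \<open>The change of a continuous logarithm of \<open>e t - c\<close> along \<open>e\<close>;
  for a closed path avoiding \<open>c\<close> it is \<open>2 * pi * \<i>\<close> times the winding
  number. The choice of the lift is immaterial by \<open>exp_lifts_diff_const\<close>; on paths
  through \<open>c\<close> the value is arbitrary.\<close>

definition log_incr :: "(real \<Rightarrow> complex) \<Rightarrow> complex \<Rightarrow> complex" where
  "log_incr e c = (SOME d. \<exists>l. continuous_on {0..1} l \<and> (\<forall>t\<in>{0..1}. e t - c = exp (l t)) \<and> d = l 1 - l 0)"

text \<open>The difference of two lifts is continuous on a connected interval with values in the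
  discrete set of multiples of \<open>2 * pi * \<i>\<close>, hence constant.\<close>

lemma exp_lifts_diff_const:
  fixes l m :: "real \<Rightarrow> complex"
  assumes l: "continuous_on {0..1} l" and m: "continuous_on {0..1} m"
    and eq: "\<And>t. t \<in> {0..1} \<Longrightarrow> exp (l t) = exp (m t)"
  shows "l 1 - l 0 = m 1 - m 0"
proof -
  have val: "\<exists>k::int. l t - m t = of_int (2 * k) * pi * \<i>" if "t \<in> {0..1}" for t
    using eq[OF that] by (auto simp: exp_eq)
  have "(\<lambda>t. l t - m t) constant_on {0..1}"
  proof (rule continuous_discrete_range_constant)
    show "continuous_on {0..1} (\<lambda>t. l t - m t)"
      using l m by (intro continuous_intros)
    fix s :: real assume s: "s \<in> {0..1}"
    \<comment> \<open>Distinct values are at least \<open>2 * pi\<close> apart; the crude gap 1 is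
      enough.\<close>
    show "\<exists>d>0. \<forall>y. y \<in> {0..1} \<and> l y - m y \<noteq> l s - m s \<longrightarrow> d \<le> norm (l y - m y - (l s - m s))"
    proof (intro exI[of _ 1] conjI allI impI)
      fix y assume y: "y \<in> {0..1} \<and> l y - m y \<noteq> l s - m s"
      obtain j k :: int where j: "l s - m s = of_int (2 * j) * pi * \<i>"
        and k: "l y - m y = of_int (2 * k) * pi * \<i>"
        using val s y by meson
      have "j \<noteq> k" using y j k by auto
      have "l y - m y - (l s - m s) = of_real (real_of_int (2 * (k - j)) * pi) * \<i>"
        by (simp add: j k algebra_simps)
      then have "norm (l y - m y - (l s - m s)) = \<bar>real_of_int (2 * (k - j)) * pi\<bar>"
        by (simp only: norm_mult norm_of_real norm_ii mult_1_right)
      also have "\<dots> = real_of_int \<bar>2 * (k - j)\<bar> * pi"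
        by (simp add: abs_mult)
      also have "\<dots> \<ge> 1 * 1"
        using \<open>j \<noteq> k\<close> pi_ge_two by (intro mult_mono) auto
      finally show "1 \<le> norm (l y - m y - (l s - m s))" by simp
    qed simp
  qed auto
  then have "l 1 - m 1 = l 0 - m 0"
    unfolding constant_on_def by auto
  then show ?thesis by (simp add: algebra_simps)
qed

lemma log_incr_eq:
  assumes "continuous_on {0..1} l" and "\<And>t. t \<in> {0..1} \<Longrightarrow> e t - c = exp (l t)"
  shows "log_incr e c = l 1 - l 0"
  unfolding log_incr_def
proof (rule some_equality)
  show "\<exists>m. continuous_on {0..1} m \<and> (\<forall>t\<in>{0..1}. e t - c = exp (m t)) \<and> l 1 - l 0 = m 1 - m 0"
    using assms by blast
next
  fix d assume "\<exists>m. continuous_on {0..1} m \<and> (\<forall>t\<in>{0..1}. e t - c = exp (m t)) \<and> d = m 1 - m 0"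
  then obtain m where "continuous_on {0..1} m" "\<forall>t\<in>{0..1}. e t - c = exp (m t)" "d = m 1 - m 0"
    by blast
  then show "d = l 1 - l 0"
    using exp_lifts_diff_const[of m l] assms by auto
qed

text \<open>The end values of a lift and the given \<open>\<alpha>\<close>, \<open>\<beta>\<close>
  are logarithms of the same numbers. This turns increments into integers once logarithms at the end
  points are fixed.\<close>

lemma log_incr_endpoints:
  assumes e: "path e" and c: "c \<notin> path_image e"
    and a: "exp \<alpha> = pathstart e - c" and b: "exp \<beta> = pathfinish e - c"
  shows "\<exists>n::int. log_incr e c = \<beta> - \<alpha> + 2 * of_int n * pi * \<i>"
proof -
  obtain l where l: "continuous_on {0..1} l" "\<And>t. t \<in> {0..1} \<Longrightarrow> e t - c = exp (l t)"
  proof (rule continuous_logarithm_on_contractible[of "{0..1::real}" "\<lambda>t. e t - c"])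
    show "continuous_on {0..1} (\<lambda>t. e t - c)"
      using e unfolding path_def by (intro continuous_intros)
    show "contractible {0..1::real}" by (simp add: convex_imp_contractible)
    show "\<And>t. t \<in> {0..1} \<Longrightarrow> e t - c \<noteq> 0" using c by (auto simp: path_image_def)
  qed blast
  have "exp (l 0) = exp \<alpha>" "exp (l 1) = exp \<beta>"
    using l(2)[of 0] l(2)[of 1] a b by (auto simp: pathstart_def pathfinish_def)
  then obtain j k :: int where "l 0 = \<alpha> + (of_int (2 * j) * pi) * \<i>" "l 1 = \<beta> + (of_int (2 * k) * pi) * \<i>"
    unfolding exp_eq by blast
  then have "log_incr e c = \<beta> - \<alpha> + 2 * of_int (k - j) * pi * \<i>"
    using log_incr_eq[OF l] by (simp add: algebra_simps)
  then show ?thesis by blast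
qed

text \<open>Both sides are the second difference over the corners of the unit square of one logarithm of
  \<open>e s - f t\<close>.\<close>
lemma log_incr_swap:
  assumes e: "path e" and f: "path f" and disj: "path_image e \<inter> path_image f = {}"
  shows "log_incr e (pathfinish f) - log_incr e (pathstart f) =
         log_incr f (pathfinish e) - log_incr f (pathstart e)"
proof -
  let ?Q = "{0..1::real} \<times> {0..1::real}"
  have ce: "continuous_on {0..1} e" and cf: "continuous_on {0..1} f"
    using e f by (auto simp: path_def)
  obtain L where L: "continuous_on ?Q L" "\<And>z. z \<in> ?Q \<Longrightarrow> e (fst z) - f (snd z) = exp (L z)"
  proof (rule continuous_logarithm_on_contractible[of ?Q "\<lambda>z. e (fst z) - f (snd z)"])
    show "continuous_on ?Q (\<lambda>z. e (fst z) - f (snd z))"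
      by (intro continuous_on_diff continuous_on_compose2[OF ce] continuous_on_compose2[OF cf]
            continuous_on_fst continuous_on_snd continuous_on_id) auto
    show "contractible ?Q" by (intro convex_imp_contractible convex_Times) auto
    show "\<And>z. z \<in> ?Q \<Longrightarrow> e (fst z) - f (snd z) \<noteq> 0"
      using disj by (fastforce simp: path_image_def)
  qed blast
  have row: "log_incr e (f t) = L (1, t) - L (0, t)" if "t \<in> {0..1}" for t
  proof (rule log_incr_eq)
    show "continuous_on {0..1} (\<lambda>s. L (s, t))"
      using that by (intro continuous_on_compose2[OF L(1)] continuous_intros) auto
    show "\<And>s. s \<in> {0..1} \<Longrightarrow> e s - f t = exp (L (s, t))"
      using L(2)[of "(_, t)"] that by auto
  qed
  have col: "log_incr f (e s) = L (s, 1) - L (s, 0)" if "s \<in> {0..1}" for s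
  proof -
    \<comment> \<open>Adding \<open>pi * \<i>\<close> to a logarithm of \<open>e s - f t\<close>
      yields one of \<open>f t - e s\<close>.\<close>
    have "log_incr f (e s) = (L (s, 1) + pi * \<i>) - (L (s, 0) + pi * \<i>)"
    proof (rule log_incr_eq)
      show "continuous_on {0..1} (\<lambda>t. L (s, t) + pi * \<i>)"
        using that by (intro continuous_on_add continuous_on_compose2[OF L(1)] continuous_intros) auto
      show "f t - e s = exp (L (s, t) + pi * \<i>)" if "t \<in> {0..1}" for t
        using L(2)[of "(s, t)"] that \<open>s \<in> {0..1}\<close> by (auto simp: exp_add algebra_simps)
    qed
    then show ?thesis by simp
  qed
  show ?thesis
    using row[of 0] row[of 1] col[of 0] col[of 1] by (simp add: pathstart_def pathfinish_def)
qed

section \<open>Non-planarity of the complete graph on five vertices\<close>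

text \<open>Relative to fixed logarithms of the differences \<open>x j - x k\<close>, the increment of a logarithm of
  \<open>e i j - x k\<close> is an integer \<open>N i j k\<close> of full turns. Modulo 2, the swap identity for a pair of
  independent edges expresses the sum of four of these integers by the number of interleavings of
  the two index pairs. Summing over the 15 pairs, every \<open>N i j k\<close> occurs twice, but
  exactly five pairs interleave.\<close>
theorem K5_nonplanar:
  fixes x :: "nat \<Rightarrow> complex" and e :: "nat \<Rightarrow> nat \<Rightarrow> real \<Rightarrow> complex"
  assumes e: "\<And>i j. i < j \<Longrightarrow> j < 5 \<Longrightarrow> path (e i j) \<and> pathstart (e i j) = x i \<and> pathfinish (e i j) = x j"
    and disj: "\<And>i j k l. i < j \<Longrightarrow> j < 5 \<Longrightarrow> k < l \<Longrightarrow> l < 5 \<Longrightarrow> {i, j} \<inter> {k, l} = {} \<Longrightarrow>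
      path_image (e i j) \<inter> path_image (e k l) = {}"
  shows False
proof -
  have endp: "x i \<in> path_image (e i j)" "x j \<in> path_image (e i j)" if "i < j" "j < 5" for i j
    using e[OF that] pathstart_in_path_image[of "e i j"] pathfinish_in_path_image[of "e i j"] by auto
  have avoid: "x k \<notin> path_image (e i j)" if "i < j" "j < 5" "k < 5" "k \<noteq> i" "k \<noteq> j" for i j k
  proof -
    \<comment> \<open>The edge joining \<open>k\<close> to a further vertex \<open>l\<close>
      contains \<open>x k\<close> and is independent of the edge \<open>i j\<close>.\<close>
    have "\<exists>l<5. l \<noteq> i \<and> l \<noteq> j \<and> l \<noteq> k" by presburger
    then obtain l where "l < 5" "l \<notin> {i, j, k}" by blast
    then show ?thesis
      using disj[of i j k l] disj[of i j l k] endp[of k l] endp[of l k] that by (cases "k < l") auto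
  qed
  have ne: "x i \<noteq> x j" if "i < 5" "j < 5" "i \<noteq> j" for i j
  proof -
    have "\<exists>l<5. l \<noteq> i \<and> l \<noteq> j" by presburger
    then obtain l where "l < 5" "l \<notin> {i, j}" by blast
    then show ?thesis
      using avoid[of i l j] avoid[of l i j] endp[of i l] endp[of l i] that by (cases "i < l") auto
  qed
  \<comment> \<open>The logarithms are chosen so that exchanging the indices changes them by exactly
    \<open>pi * \<i>\<close> up to the sign \<open>sg\<close>, with no unknown full turns.\<close>
  define lam where "lam k j = (if k < j then Ln (x j - x k) else Ln (x k - x j) + pi * \<i>)" for k j
  have lam: "exp (lam k j) = x j - x k" if "k < 5" "j < 5" "k \<noteq> j" for k j
    using ne[OF that] by (auto simp: lam_def exp_add)
  define sg :: "nat \<Rightarrow> nat \<Rightarrow> int" where "sg k j = (if k < j then -1 else 1)" for k j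
  have lam_sym: "lam k j = lam j k + of_int (sg k j) * pi * \<i>" if "k \<noteq> j" for k j
    using that by (auto simp: lam_def sg_def)
  have "\<exists>n::int. log_incr (e i j) (x k) = lam k j - lam k i + 2 * of_int n * pi * \<i>"
    if "i < j" "j < 5" "k < 5" "k \<noteq> i" "k \<noteq> j" for i j k
    using e[OF that(1,2)] avoid[OF that] lam[of k i] lam[of k j] that
    by (intro log_incr_endpoints) auto
  then obtain N :: "nat \<Rightarrow> nat \<Rightarrow> nat \<Rightarrow> int" where
    N: "\<And>i j k. i < j \<Longrightarrow> j < 5 \<Longrightarrow> k < 5 \<Longrightarrow> k \<noteq> i \<Longrightarrow> k \<noteq> j \<Longrightarrow>
      log_incr (e i j) (x k) = lam k j - lam k i + 2 * of_int (N i j k) * pi * \<i>"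
    by metis
  have eq: "2 * (N i j l - N i j k - N k l j + N k l i) + sg l j - sg l i - sg k j + sg k i = 0"
    if "i < j" "j < 5" "k < l" "l < 5" "{i, j} \<inter> {k, l} = {}" for i j k l
  proof -
    have d: "i \<noteq> k" "i \<noteq> l" "j \<noteq> k" "j \<noteq> l" "k < 5" "i < 5" using that by auto
    have "log_incr (e i j) (x l) - log_incr (e i j) (x k) = log_incr (e k l) (x j) - log_incr (e k l) (x i)"
      using log_incr_swap[of "e i j" "e k l"] e[of i j] e[of k l] disj[OF that] that by simp
    then have "of_int (2 * (N i j l - N i j k - N k l j + N k l i) + sg l j - sg l i - sg k j + sg k i)
        * (pi * \<i>) = 0"
      using that d N[of i j l] N[of i j k] N[of k l j] N[of k l i]
        lam_sym[of l j] lam_sym[of l i] lam_sym[of k j] lam_sym[of k i]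
      by (simp add: algebra_simps)
    then show ?thesis
      by (simp only: mult_eq_0_iff of_int_eq_0_iff of_real_eq_0_iff pi_neq_zero complex_i_not_zero) simp
  qed
  \<comment> \<open>The 15 instances, each halved, are added. All have \<open>i < k\<close>, so an
    interleaved pair \<open>i < k < j < l\<close> contributes 1 and any other pair 0. The two
    occurrences of each integer either cancel or double.\<close>
  have "2 * (N 0 1 4 - N 0 1 2 + N 0 2 4 - N 0 2 1 + N 0 3 4 - N 0 3 1 + N 0 4 3 - N 0 4 1
      + N 1 2 0 - N 1 2 3 + N 1 3 0 - N 1 3 2 + N 1 4 0 - N 1 4 2 + N 2 3 0 - N 2 3 4
      + N 2 4 0 - N 2 4 3 + N 3 4 0 - N 3 4 2) = -5"
    using eq[of 0 2 1 3] eq[of 0 2 1 4] eq[of 0 3 1 2] eq[of 0 3 1 4] eq[of 0 4 1 2]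
      eq[of 0 4 1 3] eq[of 0 1 2 3] eq[of 0 1 2 4] eq[of 0 3 2 4] eq[of 0 4 2 3]
      eq[of 0 1 3 4] eq[of 0 2 3 4] eq[of 1 3 2 4] eq[of 1 4 2 3] eq[of 1 2 3 4]
    by (simp add: sg_def)
  then show False by presburger
qed

section \<open>The polygonal path metric\<close>

text \<open>Makes the set under the infimum in \<open>gdist\<close> nonempty, so that the infimum is
  approached by actual paths.\<close>

definition poly_connected :: "pt set \<Rightarrow> bool" where
  "poly_connected P \<longleftrightarrow> (\<forall>a\<in>P. \<forall>b\<in>P. \<exists>ps. poly_path_in P ps a b)"

lemma poly_len_singleton [simp]: "poly_len [a] = 0"
  by (simp add: poly_len_def)

lemma poly_len_Cons [simp]: "poly_len (a # b # ps) = dist a b + poly_len (b # ps)"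
  by (simp add: poly_len_def sum.lessThan_Suc_shift del: sum.lessThan_Suc)

lemma poly_len_nonneg: "0 \<le> poly_len ps"
  by (simp add: poly_len_def sum_nonneg)

lemma poly_path_in_singleton [simp]: "poly_path_in P [a] x y \<longleftrightarrow> x = a \<and> y = a"
  by (auto simp: poly_path_in_def)

lemma poly_path_in_Cons [simp]:
  "poly_path_in P (a # b # ps) x y \<longleftrightarrow>
     x = a \<and> closed_segment a b \<subseteq> P \<and> poly_path_in P (b # ps) b y"
  by (auto simp: poly_path_in_def All_less_Suc2)

lemma poly_path_in_trans:
  assumes "poly_path_in P ps a b" and "poly_path_in P qs b c"
  shows "\<exists>rs. poly_path_in P rs a c \<and> poly_len rs = poly_len ps + poly_len qs"
  using assms
proof (induction ps arbitrary: a)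
  case Nil
  then show ?case by (simp add: poly_path_in_def)
next
  case (Cons x ps)
  show ?case
  proof (cases ps)
    case Nil
    then show ?thesis using Cons.prems by auto
  next
    case (Cons y ps')
    with Cons.prems have "poly_path_in P ps y b" "a = x" "closed_segment x y \<subseteq> P" by auto
    moreover from Cons.IH[OF this(1) Cons.prems(2)] obtain rs
      where rs: "poly_path_in P rs y c" "poly_len rs = poly_len ps + poly_len qs" by blast
    moreover from rs(1) obtain rs' where "rs = y # rs'"
      by (cases rs) (auto simp: poly_path_in_def)
    ultimately have "poly_path_in P (x # rs) a c \<and> poly_len (x # rs) = poly_len (x # ps) + poly_len qs"
      using Cons by auto
    then show ?thesis by blast
  qed
qed

lemma poly_path_in_segment: "closed_segment a b \<subseteq> P \<Longrightarrow> poly_path_in P [a, b] a b"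
  by simp

lemma poly_path_in_rev:
  assumes "poly_path_in P ps a b"
  shows "\<exists>qs. poly_path_in P qs b a \<and> poly_len qs = poly_len ps"
  using assms
proof (induction ps arbitrary: a)
  case Nil
  then show ?case by (simp add: poly_path_in_def)
next
  case (Cons x ps)
  show ?case
  proof (cases ps)
    case Nil
    then show ?thesis using Cons.prems by (auto intro: exI[of _ "[x]"])
  next
    case (Cons y ps')
    with Cons.prems have *: "poly_path_in P ps y b" "a = x" "closed_segment x y \<subseteq> P" by auto
    from Cons.IH[OF *(1)] obtain qs where qs: "poly_path_in P qs b y" "poly_len qs = poly_len ps"
      by blast
    have "poly_path_in P [y, x] y x" using * by (simp add: closed_segment_commute)
    from poly_path_in_trans[OF qs(1) this] show ?thesis
      using * qs(2) Cons by (auto simp: dist_commute)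
  qed
qed

lemma gdist_le: "poly_path_in P ps a b \<Longrightarrow> gdist P a b \<le> poly_len ps"
  unfolding gdist_def
  by (rule cInf_lower) (auto intro!: bdd_belowI[of _ 0] poly_len_nonneg)

text \<open>Stands in for the existence of shortest paths; it suffices where a distance comparison
  leaves some slack.\<close>

lemma gdist_approx:
  assumes "poly_connected P" "a \<in> P" "b \<in> P" "gdist P a b < r"
  obtains ps where "poly_path_in P ps a b" "poly_len ps < r"
proof -
  have "{poly_len ps | ps. poly_path_in P ps a b} \<noteq> {}"
    using assms by (auto simp: poly_connected_def)
  from cInf_lessD[OF this] assms(4) show ?thesis
    using that unfolding gdist_def by auto
qed

lemma gdist_commute: "gdist P a b = gdist P b a"
proof -
  have "{poly_len ps | ps. poly_path_in P ps a b} \<subseteq> {poly_len ps | ps. poly_path_in P ps b a}" for a b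
    using poly_path_in_rev[of P _ a b] by clarsimp metis
  then show ?thesis unfolding gdist_def by (intro arg_cong[of _ _ Inf] equalityI)
qed

lemma gdist_triangle:
  assumes "poly_connected P" "a \<in> P" "b \<in> P" "c \<in> P"
  shows "gdist P a c \<le> gdist P a b + gdist P b c"
proof (rule field_le_epsilon)
  fix d :: real assume "d > 0"
  obtain ps where ps: "poly_path_in P ps a b" "poly_len ps < gdist P a b + d / 2"
    using gdist_approx[OF assms(1-3), of "gdist P a b + d / 2"] \<open>d > 0\<close> by auto
  obtain qs where qs: "poly_path_in P qs b c" "poly_len qs < gdist P b c + d / 2"
    using gdist_approx[OF assms(1,3,4), of "gdist P b c + d / 2"] \<open>d > 0\<close> by auto
  obtain rs where "poly_path_in P rs a c" "poly_len rs = poly_len ps + poly_len qs"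
    using poly_path_in_trans[OF ps(1) qs(1)] by blast
  with gdist_le[OF this(1)] ps qs show "gdist P a c \<le> gdist P a b + gdist P b c + d" by simp
qed

lemma gdist_segment_le:
  assumes "closed_segment a b \<subseteq> P"
  shows "gdist P a b \<le> dist a b"
  using gdist_le[OF poly_path_in_segment[OF assms]] by simp

lemma gdist_self_le: "gdist P a a \<le> 0"
  using gdist_le[of P "[a]" a a] by simp

text \<open>A point \<open>z\<close> of the traced curve cuts the polygonal path into two pieces
  with total length \<open>poly_len ps\<close>, and each piece bounds one of the two
  distances.\<close>

lemma poly_path_realization:
  assumes P: "poly_connected P" and "poly_path_in P ps a b" "a \<in> P"
  shows "\<exists>g. path g \<and> pathstart g = a \<and> pathfinish g = b \<and>
    (\<forall>z\<in>path_image g. z \<in> P \<and> gdist P a z + gdist P z b \<le> poly_len ps)"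
  using assms(2,3)
proof (induction ps arbitrary: a)
  case Nil
  then show ?case by (simp add: poly_path_in_def)
next
  case (Cons x ps)
  show ?case
  proof (cases ps)
    case Nil
    then show ?thesis
      using Cons.prems gdist_self_le[of P a]
      by (intro exI[of _ "\<lambda>_. a"]) (auto simp: path_def pathstart_def pathfinish_def path_image_def)
  next
    case (Cons y ps')
    with Cons.prems have *: "poly_path_in P ps y b" "a = x" "closed_segment x y \<subseteq> P" by auto
    then have y: "y \<in> P" by auto
    from Cons.IH[OF *(1) y] obtain g where g: "path g" "pathstart g = y" "pathfinish g = b"
      "\<And>z. z \<in> path_image g \<Longrightarrow> z \<in> P \<and> gdist P y z + gdist P z b \<le> poly_len ps" by blast
    have len: "poly_len (x # ps) = dist x y + poly_len ps" using Cons by simp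
    have b: "b \<in> P" using g(1,3,4) pathfinish_in_path_image[of g] by auto
    have "z \<in> P \<and> gdist P x z + gdist P z b \<le> dist x y + poly_len ps"
      if "z \<in> path_image (linepath x y +++ g)" for z
    proof -
      have "z \<in> closed_segment x y \<or> z \<in> path_image g"
        using that g by (simp add: path_image_join)
      then show ?thesis
      proof
        assume z: "z \<in> closed_segment x y"
        then have zP: "z \<in> P" using * by auto
        have "closed_segment x z \<subseteq> P" "closed_segment z y \<subseteq> P"
          using z *(3) subset_closed_segment[of x z x y] subset_closed_segment[of z y x y] by auto
        then have "gdist P x z \<le> dist x z" "gdist P z y \<le> dist z y"
          by (auto intro: gdist_segment_le)
        moreover have "dist x y = dist x z + dist z y"
          using z by (metis between between_mem_segment)
        moreover have "gdist P z b \<le> gdist P z y + gdist P y b"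
          using gdist_triangle[OF P zP y b] .
        moreover have "gdist P y b \<le> poly_len ps" using gdist_le[OF *(1)] .
        ultimately show ?thesis using zP by simp
      next
        assume z: "z \<in> path_image g"
        have "gdist P x z \<le> gdist P x y + gdist P y z"
          using gdist_triangle[OF P, of x y z] g(4)[OF z] y Cons.prems * by auto
        moreover have "gdist P x y \<le> dist x y" using gdist_segment_le[OF *(3)] .
        ultimately show ?thesis using g(4)[OF z] by simp
      qed
    qed
    then show ?thesis
      using g *(2) by (intro exI[of _ "linepath x y +++ g"]) (auto simp: len)
  qed
qed

section \<open>Pairs of sites with an empty disk\<close>

text \<open>A nearly shortest path from a site \<open>a\<close> to the centre \<open>p\<close> of an empty disk stays in the
  Voronoi cell of \<open>a\<close>.\<close>
lemma path_in_Voronoi_cell: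
  assumes P: "poly_connected P" and "a \<in> P" "p \<in> P" and T: "finite T" "T \<subseteq> P"
    and lt: "\<And>c. c \<in> T \<Longrightarrow> gdist P p a < gdist P p c"
  shows "\<exists>g. path g \<and> pathstart g = a \<and> pathfinish g = p \<and>
    (\<forall>z\<in>path_image g. \<forall>c\<in>T. gdist P z a < gdist P z c)"
proof -
  \<comment> \<open>The slack between \<open>a\<close> and the other sites: a path from
    \<open>a\<close> to \<open>p\<close> shorter than \<open>r\<close> exists, while every site of
    \<open>T\<close> is at distance at least \<open>r\<close> from \<open>p\<close>.\<close>
  have "\<exists>r > gdist P a p. \<forall>c\<in>T. r \<le> gdist P p c"
  proof (cases "T = {}")
    case True
    then show ?thesis using gt_ex by auto
  next
    case False
    then show ?thesis
      using T(1) lt by (intro exI[of _ "Min (gdist P p ` T)"]) (auto simp: gdist_commute[of P a])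
  qed
  then obtain r where r: "gdist P a p < r" "\<And>c. c \<in> T \<Longrightarrow> r \<le> gdist P p c" by blast
  obtain ps where ps: "poly_path_in P ps a p" "poly_len ps < r"
    using gdist_approx[OF P assms(2,3) r(1)] .
  obtain g where g: "path g" "pathstart g = a" "pathfinish g = p"
    "\<And>z. z \<in> path_image g \<Longrightarrow> z \<in> P \<and> gdist P a z + gdist P z p \<le> poly_len ps"
    using poly_path_realization[OF P ps(1) assms(2)] by blast
  have "gdist P z a < gdist P z c" if "z \<in> path_image g" "c \<in> T" for z c
  proof -
    \<comment> \<open>If \<open>c\<close> were as close to \<open>z\<close> as \<open>a\<close> is,
      going from \<open>p\<close> via \<open>z\<close> to \<open>c\<close> would take at most
      \<open>poly_len ps < r\<close>.\<close>
    have "gdist P p c \<le> gdist P p z + gdist P z c"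
      using gdist_triangle[OF P, of p z c] assms(3) T(2) that g(4) by auto
    then show ?thesis
      using g(4)[OF that(1)] r(2)[OF that(2)] ps(2)
      by (simp add: gdist_commute[of P z a] gdist_commute[of P p z])
  qed
  then show ?thesis using g by blast
qed

text \<open>The paths from \<open>a\<close> and \<open>b\<close> are joined at the common centre
  \<open>p\<close>. The sites \<open>a\<close> and \<open>b\<close> are not compared with each
  other, so the nearer end \<open>s\<close> may change along the curve.\<close>

lemma path_in_two_Voronoi_cells:
  assumes P: "poly_connected P" and "a \<in> P" "b \<in> P" "p \<in> P" and T: "finite T" "T \<subseteq> P"
    and eq: "gdist P p a = gdist P p b" and lt: "\<And>c. c \<in> T \<Longrightarrow> gdist P p a < gdist P p c"
  shows "\<exists>g. path g \<and> pathstart g = a \<and> pathfinish g = b \<and>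
    (\<forall>z\<in>path_image g. \<exists>s\<in>{a, b}. \<forall>c\<in>T. gdist P z s < gdist P z c)"
proof -
  obtain g where g: "path g" "pathstart g = a" "pathfinish g = p"
    "\<forall>z\<in>path_image g. \<forall>c\<in>T. gdist P z a < gdist P z c"
    using path_in_Voronoi_cell[OF P assms(2,4) T lt] by blast
  obtain h where h: "path h" "pathstart h = b" "pathfinish h = p"
    "\<forall>z\<in>path_image h. \<forall>c\<in>T. gdist P z b < gdist P z c"
    using path_in_Voronoi_cell[OF P assms(3,4) T] lt eq by auto
  show ?thesis
    using g h by (intro exI[of _ "g +++ reversepath h"]) (auto simp: path_image_join)
qed

text \<open>The curves through the centres \<open>p i j\<close> would draw the complete graph on
  five vertices with independent edges disjoint.\<close>

theorem five_sites_pair_without_empty_disk: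
  fixes f :: "nat \<Rightarrow> pt"
  assumes P: "poly_connected P" and f: "\<And>i. i < 5 \<Longrightarrow> f i \<in> P"
    and p: "\<And>i j. i < j \<Longrightarrow> j < 5 \<Longrightarrow> p i j \<in> P \<and> gdist P (p i j) (f i) = gdist P (p i j) (f j) \<and>
      (\<forall>k<5. k \<noteq> i \<longrightarrow> k \<noteq> j \<longrightarrow> gdist P (p i j) (f i) < gdist P (p i j) (f k))"
  shows False
proof -
  have "\<exists>g. path g \<and> pathstart g = f i \<and> pathfinish g = f j \<and>
    (\<forall>z\<in>path_image g. \<exists>s\<in>{f i, f j}. \<forall>c\<in>f ` ({..<5} - {i, j}). gdist P z s < gdist P z c)"
    if "i < j" "j < 5" for i j
    using p[OF that] f that by (intro path_in_two_Voronoi_cells[OF P, where p = "p i j"]) auto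
  then obtain g where g: "\<And>i j. i < j \<Longrightarrow> j < 5 \<Longrightarrow>
      path (g i j) \<and> pathstart (g i j) = f i \<and> pathfinish (g i j) = f j \<and>
      (\<forall>z\<in>path_image (g i j). \<exists>s\<in>{f i, f j}. \<forall>c\<in>f ` ({..<5} - {i, j}). gdist P z s < gdist P z c)"
    by metis
  have disj: "path_image (g i j) \<inter> path_image (g k l) = {}"
    if ij: "i < j" "j < 5" and kl: "k < l" "l < 5" and d: "{i, j} \<inter> {k, l} = {}" for i j k l
  proof (rule equals0I)
    fix z assume z: "z \<in> path_image (g i j) \<inter> path_image (g k l)"
    obtain s where s: "s \<in> {f i, f j}" "\<And>c. c \<in> f ` ({..<5} - {i, j}) \<Longrightarrow> gdist P z s < gdist P z c"
      using g[OF ij] z by blast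
    obtain t where t: "t \<in> {f k, f l}" "\<And>c. c \<in> f ` ({..<5} - {k, l}) \<Longrightarrow> gdist P z t < gdist P z c"
      using g[OF kl] z by blast
    \<comment> \<open>At a common point each of \<open>s\<close> and \<open>t\<close> would be
      strictly nearer than the other.\<close>
    have "t \<in> f ` ({..<5} - {i, j})" "s \<in> f ` ({..<5} - {k, l})"
      using s(1) t(1) ij kl d by auto
    then show False using s(2)[of t] t(2)[of s] by simp
  qed
  \<comment> \<open>The plane is identified with the complex numbers, where the logarithm argument
    takes place.\<close>
  define \<Phi> :: "pt \<Rightarrow> complex" where "\<Phi> v = Complex (v $ 1) (v $ 2)" for v
  have cont: "continuous_on A \<Phi>" for A
    unfolding \<Phi>_def Complex_eq by (intro continuous_intros)
  have inj: "inj \<Phi>"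
    by (auto simp: inj_def \<Phi>_def vec_eq_iff forall_2)
  show False
  proof (rule K5_nonplanar[of "\<lambda>i j. \<Phi> \<circ> g i j" "\<lambda>i. \<Phi> (f i)"])
    fix i j :: nat assume ij: "i < j" "j < 5"
    show "path (\<Phi> \<circ> g i j) \<and> pathstart (\<Phi> \<circ> g i j) = \<Phi> (f i) \<and> pathfinish (\<Phi> \<circ> g i j) = \<Phi> (f j)"
      using g[OF ij] cont by (auto simp: path_continuous_image pathstart_compose pathfinish_compose)
  next
    fix i j k l :: nat
    assume "i < j" "j < 5" "k < l" "l < 5" "{i, j} \<inter> {k, l} = {}"
    from disj[OF this] show "path_image (\<Phi> \<circ> g i j) \<inter> path_image (\<Phi> \<circ> g k l) = {}"
      by (simp add: path_image_compose image_Int[OF inj, symmetric])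
  qed
qed

section \<open>Polygonal connectedness of polygon regions\<close>

text \<open>Every point is joined to \<open>vs ! 0\<close>: a vertex along the edges, a boundary
  point along its edge to a vertex, an inside point straight to its nearest boundary point.\<close>

lemma polygon_region_poly_connected:
  assumes "vs \<noteq> []"
  shows "poly_connected (polygon_region vs)"
proof -
  let ?P = "polygon_region vs" and ?B = "polygon_boundary vs"
  let ?R = "\<lambda>a b. \<exists>ps. poly_path_in ?P ps a b"
  have trans: "?R a c" if "?R a b" "?R b c" for a b c
    using that poly_path_in_trans by blast
  have sym: "?R b a" if "?R a b" for a b
    using that poly_path_in_rev by blast
  have seg: "?R a b" if "closed_segment a b \<subseteq> ?P" for a b
    using poly_path_in_segment[OF that] by blast
  have edge: "pedge vs i \<subseteq> ?P" if "i < length vs" for i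
    using that by (auto simp: polygon_region_def polygon_boundary_def)
  have vert: "?R (vs ! 0) (vs ! i)" if "i < length vs" for i
    using that
  proof (induction i)
    case 0
    show ?case by (rule exI[of _ "[vs ! 0]"]) simp
  next
    case (Suc i)
    then have "closed_segment (vs ! i) (vs ! Suc i) \<subseteq> ?P"
      using edge[of i] by (simp add: pedge_def)
    then show ?case using Suc trans seg by (meson Suc_lessD)
  qed
  have bd: "?R (vs ! 0) z" if z: "z \<in> ?B" for z
  proof -
    obtain i where i: "i < length vs" "z \<in> pedge vs i"
      using z by (auto simp: polygon_boundary_def)
    then have "closed_segment (vs ! i) z \<subseteq> pedge vs i"
      by (simp add: pedge_def subset_closed_segment)
    then show ?thesis using vert[OF i(1)] seg[of "vs ! i" z] edge[OF i(1)] trans by blast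
  qed
  have "closed ?B" unfolding polygon_boundary_def pedge_def by (intro closed_UN) auto
  have "vs ! 0 \<in> ?B"
    using assms unfolding polygon_boundary_def pedge_def by (intro UN_I[of 0]) auto
  have ins: "?R (vs ! 0) z" if z: "z \<in> inside ?B" for z
  proof -
    define w where "w = closest_point ?B z"
    have w: "w \<in> ?B" "\<And>y. y \<in> ?B \<Longrightarrow> dist z w \<le> dist z y"
      using closest_point_exists[OF \<open>closed ?B\<close>] \<open>vs ! 0 \<in> ?B\<close> by (auto simp: w_def)
    have "z \<noteq> w" using z w(1) by (auto simp: inside_def)
    \<comment> \<open>The open ball reaching to the nearest boundary point is connected and misses
      the boundary, so it stays in the component of \<open>z\<close>.\<close>
    have "ball z (dist z w) \<subseteq> inside ?B"
    proof
      fix y assume y: "y \<in> ball z (dist z w)"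
      have "ball z (dist z w) \<subseteq> - ?B" using w(2) by (auto simp: not_le[symmetric])
      then have "connected_component (- ?B) z y"
        unfolding connected_component_def
        using y \<open>z \<noteq> w\<close> by (intro exI[of _ "ball z (dist z w)"]) auto
      then show "y \<in> inside ?B" using inside_same_component z by blast
    qed
    moreover have "y \<in> ball z (dist z w)" if "y \<in> closed_segment w z" "y \<noteq> w" for y
    proof -
      have "dist w z = dist w y + dist y z"
        using that by (metis between between_mem_segment)
      then show ?thesis using that(2) by (simp add: dist_commute)
    qed
    ultimately have "closed_segment w z \<subseteq> ?P"
      using w(1) unfolding polygon_region_def by blast
    then show ?thesis using trans[OF bd[OF w(1)] seg] by blast
  qed
  have "?R (vs ! 0) z" if "z \<in> ?P" for z
    using that bd ins by (auto simp: polygon_region_def)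
  then show ?thesis
    unfolding poly_connected_def using trans sym by blast
qed

section \<open>Counting\<close>

text \<open>Once the other coordinates are fixed, at most \<open>K\<close> values remain for
  coordinate \<open>k\<close>. Resetting \<open>f k\<close> to \<open>undefined\<close> expresses
  that the set \<open>B\<close> does not depend on it.\<close>

lemma card_PiE_coordinate_le:
  assumes I: "finite I" "k \<in> I" and S: "finite S"
    and B: "\<And>f. f \<in> I - {k} \<rightarrow>\<^sub>E S \<Longrightarrow> finite (B f) \<and> card (B f) \<le> K"
  shows "card {f \<in> I \<rightarrow>\<^sub>E S. f k \<in> B (f(k := undefined))} \<le> card S ^ (card I - 1) * K"
proof -
  let ?F = "I - {k} \<rightarrow>\<^sub>E S" and ?h = "\<lambda>f. (f(k := undefined), f k)"
  have fin: "finite ?F" using I S by (intro finite_PiE) auto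
  have "card {f \<in> I \<rightarrow>\<^sub>E S. f k \<in> B (f(k := undefined))} \<le> card (Sigma ?F B)"
  proof (rule card_inj_on_le)
    show "inj_on ?h {f \<in> I \<rightarrow>\<^sub>E S. f k \<in> B (f(k := undefined))}"
      by (rule inj_onI) (metis Pair_inject fun_upd_triv fun_upd_upd)
    show "?h ` {f \<in> I \<rightarrow>\<^sub>E S. f k \<in> B (f(k := undefined))} \<subseteq> Sigma ?F B"
      using I by (auto simp: PiE_iff extensional_def split: if_splits)
    show "finite (Sigma ?F B)" using fin B by (intro finite_SigmaI) auto
  qed
  also have "\<dots> = (\<Sum>f\<in>?F. card (B f))" using fin B by (simp add: card_SigmaI)
  also have "\<dots> \<le> (\<Sum>f\<in>?F. K)" using B by (intro sum_mono) auto
  also have "\<dots> = card S ^ (card I - 1) * K" using I by (simp add: card_PiE)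
  finally show ?thesis .
qed

text \<open>Union bound: each of the \<open>5 * 4 * 3 = 60\<close> ordered triples of distinct
  indices spoils at most \<open>card S ^ 4 * K\<close> of the \<open>card S ^ 5\<close> maps. The
  maps may repeat values, so \<open>B u u\<close> must be bounded too.\<close>

lemma exists_five_avoiding:
  fixes B :: "'a \<Rightarrow> 'a \<Rightarrow> 'a set"
  assumes S: "finite S" and B: "\<And>u v. u \<in> S \<Longrightarrow> v \<in> S \<Longrightarrow> finite (B u v) \<and> card (B u v) \<le> K"
    and K: "60 * K < card S"
  shows "\<exists>f. (\<forall>i<5::nat. f i \<in> S) \<and>
    (\<forall>i<5. \<forall>j<5. \<forall>k<5. i \<noteq> j \<longrightarrow> k \<noteq> i \<longrightarrow> k \<noteq> j \<longrightarrow> f k \<notin> B (f i) (f j))"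
proof -
  let ?I = "{..<5::nat}"
  define X where "X = (SIGMA i:?I. SIGMA j:?I - {i}. ?I - {i, j})"
  define E where "E = (\<lambda>(i, j, k). {f \<in> ?I \<rightarrow>\<^sub>E S. f k \<in> B (f i) (f j)})"
  have "card (?I - {i, j}) = 3" if "i \<in> ?I" "j \<in> ?I - {i}" for i j
    using that by (subst card_Diff_subset) auto
  then have cX: "card X = 60" "finite X"
    unfolding X_def by (simp_all add: card_SigmaI)
  have E: "card (E t) \<le> card S ^ 4 * K" if X: "t \<in> X" for t
  proof -
    obtain i j k where t: "t = (i, j, k)" "i \<in> ?I" "j \<in> ?I" "k \<in> ?I" "k \<noteq> i" "k \<noteq> j"
      using X by (auto simp: X_def)
    have "card {f \<in> ?I \<rightarrow>\<^sub>E S. f k \<in> (\<lambda>f. B (f i) (f j)) (f(k := undefined))} \<le> card S ^ (card ?I - 1) * K"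
      using t S B by (intro card_PiE_coordinate_le) (auto simp: PiE_iff)
    then show ?thesis using t by (simp add: E_def)
  qed
  have "card (\<Union>t\<in>X. E t) \<le> (\<Sum>t\<in>X. card (E t))" using cX by (intro card_UN_le)
  also have "\<dots> \<le> (\<Sum>t\<in>X. card S ^ 4 * K)" using E by (intro sum_mono)
  also have "\<dots> = card S ^ 4 * (60 * K)" using cX by simp
  also have "\<dots> < card S ^ 4 * card S" using K by (intro mult_strict_left_mono) auto
  also have "\<dots> = card (?I \<rightarrow>\<^sub>E S)" by (simp add: card_PiE eval_nat_numeral)
  finally have "\<not> ?I \<rightarrow>\<^sub>E S \<subseteq> (\<Union>t\<in>X. E t)"
  proof -
    assume lt: "card (\<Union>t\<in>X. E t) < card (?I \<rightarrow>\<^sub>E S)"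
    have "finite (?I \<rightarrow>\<^sub>E S)" using S by (intro finite_PiE) auto
    then have "finite (\<Union>t\<in>X. E t)" using cX(2) by (auto simp: E_def)
    then show ?thesis using lt card_mono by (metis leD)
  qed
  then obtain f where f: "f \<in> ?I \<rightarrow>\<^sub>E S" "f \<notin> (\<Union>t\<in>X. E t)" by blast
  have "f k \<notin> B (f i) (f j)" if "i < 5" "j < 5" "k < 5" "i \<noteq> j" "k \<noteq> i" "k \<noteq> j" for i j k
    using f that by (force simp: X_def E_def)
  then show ?thesis using f(1) by (intro exI[of _ f]) (auto simp: PiE_iff)
qed

section \<open>The lower bound, from counting and non-planarity\<close>

theorem theorem1:
  fixes n :: nat and vs :: "pt list" and S :: "pt set"
  assumes "n \<ge> 5"
    and "simple_polygon_vertices vs"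
    and "finite S" and "card S = n" and "S \<subseteq> polygon_region vs"
    and "general_position vs S"
  shows "\<exists>u\<in>S. \<exists>v\<in>S. u \<noteq> v \<and>
           (\<forall>c\<in>polygon_region vs. \<forall>r.
              gdist (polygon_region vs) c u = r \<and> gdist (polygon_region vs) c v = r \<longrightarrow>
              int (card (S \<inter> gdisk (polygon_region vs) c r)) \<ge> \<lceil>(real n - 2) / 60\<rceil>)"
proof (rule ccontr)
  assume neg: "\<not> ?thesis"
  let ?P = "polygon_region vs"
  have P: "poly_connected ?P"
    using assms(2) by (intro polygon_region_poly_connected) (auto simp: simple_polygon_vertices_def)
  have "\<exists>c\<in>?P. gdist ?P c u = gdist ?P c v \<and>
      int (card (S \<inter> gdisk ?P c (gdist ?P c u))) < \<lceil>(real n - 2) / 60\<rceil>"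
    if "u \<in> S" "v \<in> S" "u \<noteq> v" for u v
    using neg that by (simp add: not_le) metis
  then obtain c where c: "\<And>u v. u \<in> S \<Longrightarrow> v \<in> S \<Longrightarrow> u \<noteq> v \<Longrightarrow> c u v \<in> ?P \<and>
      gdist ?P (c u v) u = gdist ?P (c u v) v \<and>
      int (card (S \<inter> gdisk ?P (c u v) (gdist ?P (c u v) u))) < \<lceil>(real n - 2) / 60\<rceil>"
    by metis
  \<comment> \<open>The default \<open>{u}\<close> on the diagonal keeps \<open>u\<close> in
    \<open>B u v\<close> even if two of the five images coincide.\<close>
  define B where "B u v = (if u = v then {u} else S \<inter> gdisk ?P (c u v) (gdist ?P (c u v) u))" for u v
  \<comment> \<open>The largest number of sites in a disk that violates the bound.\<close>
  define K where "K = nat (\<lceil>(real n - 2) / 60\<rceil> - 1)"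
  have uB: "u \<in> B u v" if "u \<in> S" for u v
    using that assms(5) by (auto simp: B_def gdisk_def)
  have vB: "v \<in> B u v" if "u \<in> S" "v \<in> S" for u v
    using that assms(5) c[of u v] by (auto simp: B_def gdisk_def)
  have le: "int (card (B u v)) \<le> \<lceil>(real n - 2) / 60\<rceil> - 1" if "u \<in> S" "v \<in> S" "u \<noteq> v" for u v
    using conjunct2[OF conjunct2[OF c[OF that]]] that(3) by (simp add: B_def)
  \<comment> \<open>A violating disk through two distinct sites is not empty of sites, so the bound
    minus 1 is at least 1: \<open>nat\<close> truncates nothing in \<open>K\<close>, and the
    singletons \<open>B u u\<close> respect \<open>K\<close>.\<close>
  have "\<exists>u\<in>S. \<exists>v\<in>S. u \<noteq> v"
    using assms(1,3,4) card_le_Suc0_iff_eq[of S] by auto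
  then obtain u v where uv: "u \<in> S" "v \<in> S" "u \<noteq> v" by blast
  have finB: "finite (B u v)" for u v
    using assms(3) by (simp add: B_def)
  have "card (B u v) \<noteq> 0"
    using uB[OF uv(1), of v] finB by auto
  with le[OF uv] have K1: "1 \<le> \<lceil>(real n - 2) / 60\<rceil> - 1" by linarith
  have cardB: "finite (B u v) \<and> card (B u v) \<le> K" if "u \<in> S" "v \<in> S" for u v
  proof (cases "u = v")
    case True
    have "1 \<le> K" using K1 unfolding K_def by linarith
    then show ?thesis using True by (simp add: B_def)
  next
    case False
    then show ?thesis using le[OF that False] K1 finB by (simp add: K_def)
  qed
  \<comment> \<open>Subtracting 1 from the ceiling falls strictly below its argument, so
    \<open>60 * K < n - 2 < n\<close>.\<close>
  have "real_of_int (\<lceil>(real n - 2) / 60\<rceil> - 1) < (real n - 2) / 60" by linarith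
  moreover have "real K = real_of_int (\<lceil>(real n - 2) / 60\<rceil> - 1)" using K1 by (simp add: K_def)
  ultimately have "real (60 * K) < real (card S)" using assms(4) by simp
  then have "60 * K < card S" by (simp only: of_nat_less_iff)
  with exists_five_avoiding[of S B K] assms(3) cardB obtain f where
    f: "\<And>i. i < 5 \<Longrightarrow> f i \<in> S" and
    av: "\<And>i j k. i < 5 \<Longrightarrow> j < 5 \<Longrightarrow> k < (5::nat) \<Longrightarrow> i \<noteq> j \<Longrightarrow> k \<noteq> i \<Longrightarrow> k \<noteq> j \<Longrightarrow> f k \<notin> B (f i) (f j)"
    by (simp del: not_less) metis
  have inj: "f i \<noteq> f j" if "i < 5" "j < 5" "i \<noteq> j" for i j
  proof -
    \<comment> \<open>For a third index \<open>k\<close>, the set \<open>B (f i) (f k)\<close>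
      contains \<open>f i\<close> but not \<open>f j\<close>.\<close>
    have "\<exists>k<5. k \<noteq> i \<and> k \<noteq> j" by presburger
    then obtain k where k: "k < 5" "k \<noteq> i" "k \<noteq> j" by blast
    then show ?thesis using av[of i k j] that uB[OF f[of i], of "f k"] by auto
  qed
  show False
  proof (rule five_sites_pair_without_empty_disk[OF P, of f "\<lambda>i j. c (f i) (f j)"])
    show "f i \<in> ?P" if "i < 5" for i using f[OF that] assms(5) by auto
    fix i j :: nat assume ij: "i < j" "j < 5"
    then have d: "f i \<in> S" "f j \<in> S" "f i \<noteq> f j" using f inj[of i j] by auto
    \<comment> \<open>A site outside \<open>B\<close> lies outside the disk, so strictly farther
      from its centre than \<open>f i\<close>.\<close>
    have "gdist ?P (c (f i) (f j)) (f i) < gdist ?P (c (f i) (f j)) (f k)"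
      if "k < 5" "k \<noteq> i" "k \<noteq> j" for k
      using av[of i j k] ij that d f[of k] assms(5) by (auto simp: B_def gdisk_def)
    then show "c (f i) (f j) \<in> ?P \<and>
        gdist ?P (c (f i) (f j)) (f i) = gdist ?P (c (f i) (f j)) (f j) \<and>
        (\<forall>k<5. k \<noteq> i \<longrightarrow> k \<noteq> j \<longrightarrow> gdist ?P (c (f i) (f j)) (f i) < gdist ?P (c (f i) (f j)) (f k))"
      using c[OF d] by blast
  qed
qed

end
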